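(* Let $g$, $(p_k)$, $(b_n)$ and the operators $L_n^{\ast}$ be as defined in the context, and assume that the operators $L_n^{\ast}$ are positive (that is, $L_n^{\ast}(f;x)\ge 0$ for all $x\ge 0$ whenever $f\ge 0$ on $[0,\infty)$). Let $\rho(x)=1+x^2$. Then for each $f\in C_\rho^k(\mathbb{R}_0^+)$, i.e. each continuous $f:[0,\infty)\to\mathbb{R}$ with $|f(x)|\le M_f\,\rho(x)$ for some constant $M_f>0$ and all $x\ge 0$, and such that $\lim_{x\to\infty} f(x)/\rho(x)=K_f$ exists and is finite, $$\lim_{n\to\infty}\left\|L_n^{\ast}(f;\cdot)-f\right\|_\rho=0 .$$
   Context: Let $g(u)=\sum_{n=0}^{\infty}a_n u^n$ (real coefficients $a_n$) be analytic in a disk $|u|<r$ with $r>1$, and assume $g(1)\neq 0$. The Appell polynomials are $p_k(x)=\sum_{i=0}^{k}a_i\frac{x^{k-i}}{(k-i)!}$, $k=0,1,2,\dots$; equivalently $g(u)e^{ux}=\sum_{k=0}^{\infty}p_k(x)u^k$. Let $(b_n)_{n\ge 1}$ be an increasing sequence of positive reals with $\lim_{n\to\infty} b_n=\infty$ and $\lim_{n\to\infty} b_n/n=0$. The Kantorovich type Jakimovski-Leviatan operators are, for $x\ge 0$, $$L_n^{\ast}(f;x)=\frac{e^{-\frac{n}{b_n}x}}{g(1)}\,\frac{n}{b_n}\sum_{k=0}^{\infty}p_k\!\left(\frac{n}{b_n}x\right)\int_{\frac{k}{n}b_n}^{\frac{k+1}{n}b_n}f(t)\,dt .$$ The weighted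 norm is $\|h\|_\rho=\sup_{x\ge 0}\frac{|h(x)|}{\rho(x)}$, and $\mathbb{R}_0^+=[0,\infty)$. The superscript $k$ in $C_\rho^k$ is merely part of the notation of the space and is not a differentiability index. *)

theory Defs
  imports "HOL-Analysis.Analysis"
begin

(* Polymorphic in the argument, so that the same g can be evaluated on a complex disk
   and, as a real number, at 1. *)
definition gen_fun :: "(nat \<Rightarrow> real) \<Rightarrow> 'a::{real_normed_field, banach} \<Rightarrow> 'a" where
  "gen_fun a u = (\<Sum>n. of_real (a n) * u ^ n)"

definition appell :: "(nat \<Rightarrow> real) \<Rightarrow> nat \<Rightarrow> real \<Rightarrow> real" where
  "appell a k x = (\<Sum>i\<le>k. a i * (x ^ (k - i) / fact (k - i)))"

definition cell :: "(nat \<Rightarrow> real) \<Rightarrow> nat \<Rightarrow> nat \<Rightarrow> real set" where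
  "cell b n k = {real k / real n * b n .. real (k + 1) / real n * b n}"

definition JL_kantorovich ::
    "(nat \<Rightarrow> real) \<Rightarrow> (nat \<Rightarrow> real) \<Rightarrow> nat \<Rightarrow> (real \<Rightarrow> real) \<Rightarrow> real \<Rightarrow> real" where
  "JL_kantorovich a b n f x =
     exp (- (real n / b n) * x) / gen_fun a 1 * (real n / b n) *
     (\<Sum>k. appell a k (real n / b n * x) * integral (cell b n k) f)"

(* The functions for which the n-th operator makes sense at every x \<ge> 0; outside this set
   integral and suminf return unspecified values. *)
definition JL_domain :: "(nat \<Rightarrow> real) \<Rightarrow> (nat \<Rightarrow> real) \<Rightarrow> nat \<Rightarrow> (real \<Rightarrow> real) set" where
  "JL_domain a b n =
     {f. (\<forall>k. f integrable_on cell b n k) \<and>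
         (\<forall>x\<ge>0. summable (\<lambda>k. appell a k (real n / b n * x) * integral (cell b n k) f))}"

definition positive_operator ::
    "(real \<Rightarrow> real) set \<Rightarrow> ((real \<Rightarrow> real) \<Rightarrow> real \<Rightarrow> real) \<Rightarrow> bool" where
  "positive_operator D L \<longleftrightarrow>
     (\<forall>f\<in>D. (\<forall>t\<ge>0. 0 \<le> f t) \<longrightarrow> (\<forall>x\<ge>0. 0 \<le> L f x))"

definition rho :: "real \<Rightarrow> real" where
  "rho x = 1 + x\<^sup>2"

(* Functions on [0, \<infinity>) are represented by total functions of which only the values on
   [0, \<infinity>) matter. *)
definition C_rho_k :: "(real \<Rightarrow> real) set" where
  "C_rho_k = {f. continuous_on {0..} f \<and>
     (\<exists>M>0. \<forall>x\<ge>0. \<bar>f x\<bar> \<le> M * rho x) \<and>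
     (\<exists>K. ((\<lambda>x. f x / rho x) \<longlongrightarrow> K) at_top)}"

(* Taken in the extended nonnegative reals, so that an unbounded quotient has norm \<infinity>. *)
definition rho_norm :: "(real \<Rightarrow> real) \<Rightarrow> ennreal" where
  "rho_norm h = (SUP x\<in>{0..}. ennreal (\<bar>h x\<bar> / rho x))"

end

theory Submission
  imports Defs "HOL-Real_Asymp.Real_Asymp"
begin

text \<open>With \<open>\<beta> = b n / n\<close> and \<open>y = x / \<beta>\<close>, positivity of the operator makes
  \<open>w k = exp (- y) * appell a k y / g(1)\<close> a probability distribution on the naturals, and
  Cauchy products show that its second moment about \<open>y\<close> is \<open>y + c\<close> with \<open>c\<close> independent of
  \<open>x\<close> and \<open>n\<close>.  A function with a limit relative to \<open>rho\<close> satisfies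
  \<open>\<bar>f t - f x\<bar> \<le> \<epsilon> * rho x + C * (t - x)\<^sup>2\<close> for all nonnegative \<open>t\<close> and \<open>x\<close>, so the error
  at \<open>x\<close> is at most \<open>\<epsilon> * rho x + 2 * C * \<beta>\<^sup>2 * (y + c + 1)\<close>.  As \<open>\<beta>\<^sup>2 * y = \<beta> * x\<close>, the last
  term is \<open>O(\<beta>) * rho x\<close>.\<close>

section \<open>Decay of the coefficients of the generating function\<close>

text \<open>A radius above 1 leaves room for geometric decay: the series converges absolutely at
  some \<open>z > 1\<close>, and \<open>z ^ n\<close> eventually exceeds the square of
  \<open>n\<close>. Convergence of every coefficient series met in the moment computation follows
  from this one.\<close>

lemma summable_square_coeffs:
  fixes a :: "nat \<Rightarrow> real"
  assumes "1 < r" and conv: "\<And>u::complex. norm u < r \<Longrightarrow> summable (\<lambda>n. of_real (a n) * u ^ n)"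
  shows "summable (\<lambda>n. (real n)\<^sup>2 * \<bar>a n\<bar>)"
proof -
  \<comment> \<open>Two radii are taken because convergence at \<open>q\<close> becomes absolute
    convergence only at a strictly smaller \<open>z\<close>.\<close>
  obtain q where q: "1 < q" "q < r" using dense[OF assms(1)] by blast
  obtain z where z: "1 < z" "z < q" using dense[OF q(1)] by blast
  have "summable (\<lambda>n. complex_of_real (a n) * (of_real q) ^ n)"
    by (rule conv) (use q in auto)
  then have "summable (\<lambda>n. norm (complex_of_real (a n) * (of_real z) ^ n))"
    by (rule powser_insidea) (use q z in auto)
  then have sm: "summable (\<lambda>n. \<bar>a n\<bar> * z ^ n)"
    using z by (simp add: norm_mult norm_power)
  have "(\<lambda>n. (real n)\<^sup>2 / z ^ n) \<longlonglongrightarrow> 0" using z by real_asymp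
  then have "eventually (\<lambda>n. (real n)\<^sup>2 / z ^ n < 1) sequentially"
    by (rule order_tendstoD) simp
  then have "eventually (\<lambda>n. norm ((real n)\<^sup>2 * \<bar>a n\<bar>) \<le> \<bar>a n\<bar> * z ^ n) sequentially"
  proof eventually_elim
    case (elim n)
    have "(real n)\<^sup>2 \<le> z ^ n" using elim z by (simp add: field_simps)
    then show ?case using mult_left_mono[of "(real n)\<^sup>2" "z ^ n" "\<bar>a n\<bar>"] by (simp add: abs_mult mult.commute)
  qed
  then show ?thesis using sm by (rule summable_comparison_test_ev)
qed

section \<open>Moments of the exponential series\<close>

text \<open>Weighting by the index shifts the series by one place; this is the recursion behind the
  moments of the Poisson weights.\<close>

lemma exp_term_Suc:
  "real (Suc j) * (y ^ Suc j / fact (Suc j)) = y * (y ^ j / fact j)" for y :: real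
  by (simp add: field_simps del: of_nat_Suc)

lemma exp_sums: "(\<lambda>j. y ^ j / fact j) sums exp y" for y :: real
  using exp_converges[of y] by (simp add: field_simps scaleR_conv_of_real)

lemma exp_first_moment_sums: "(\<lambda>j. real j * (y ^ j / fact j)) sums (y * exp y)" for y :: real
proof -
  have "(\<lambda>j. real (Suc j) * (y ^ Suc j / fact (Suc j))) sums (y * exp y)"
    unfolding exp_term_Suc by (rule sums_mult[OF exp_sums])
  \<comment> \<open>The summand at index 0 vanishes, so the shifted series and the full one have the
    same sum.\<close>
  then show ?thesis by (subst (asm) sums_Suc_iff) simp
qed

lemma exp_second_moment_sums:
  "(\<lambda>j. (real j)\<^sup>2 * (y ^ j / fact j)) sums ((y\<^sup>2 + y) * exp y)" for y :: real
proof -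
  have eq: "(real (Suc j))\<^sup>2 * (y ^ Suc j / fact (Suc j))
      = y * (real j * (y ^ j / fact j) + y ^ j / fact j)" for j
  proof -
    have "(real (Suc j))\<^sup>2 * (y ^ Suc j / fact (Suc j)) = real (Suc j) * (y * (y ^ j / fact j))"
      unfolding exp_term_Suc[symmetric] by (simp only: power2_eq_square mult.assoc)
    then show ?thesis by (simp only: algebra_simps of_nat_Suc mult_1_right)
  qed
  have "(\<lambda>j. (real (Suc j))\<^sup>2 * (y ^ Suc j / fact (Suc j))) sums (y * (y * exp y + exp y))"
    unfolding eq by (intro sums_mult sums_add exp_sums exp_first_moment_sums)
  then have "(\<lambda>j. (real j)\<^sup>2 * (y ^ j / fact j)) sums (y * (y * exp y + exp y))"
    by (subst (asm) sums_Suc_iff) simp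
  then show ?thesis by (simp add: algebra_simps power2_eq_square)
qed

text \<open>Up to the factor \<open>exp y\<close>, these are the centered mean and the variance of
  the Poisson distribution with parameter \<open>y\<close>.\<close>

lemma exp_centered_moment_sums:
  fixes y :: real
  shows "(\<lambda>j. (real j - y) * (y ^ j / fact j)) sums 0"
    and "(\<lambda>j. (real j - y)\<^sup>2 * (y ^ j / fact j)) sums (y * exp y)"
proof -
  have "(\<lambda>j. real j * (y ^ j / fact j) - y * (y ^ j / fact j)) sums (y * exp y - y * exp y)"
    by (intro sums_diff sums_mult exp_sums exp_first_moment_sums)
  then show "(\<lambda>j. (real j - y) * (y ^ j / fact j)) sums 0" by (simp only: left_diff_distrib diff_self)
  have "(\<lambda>j. ((real j)\<^sup>2 * (y ^ j / fact j) - 2 * y * (real j * (y ^ j / fact j)))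
      + y\<^sup>2 * (y ^ j / fact j)) sums
      (((y\<^sup>2 + y) * exp y - 2 * y * (y * exp y)) + y\<^sup>2 * exp y)"
    by (intro sums_add sums_diff sums_mult exp_sums exp_first_moment_sums exp_second_moment_sums)
  moreover have "((real j)\<^sup>2 * (y ^ j / fact j) - 2 * y * (real j * (y ^ j / fact j)))
      + y\<^sup>2 * (y ^ j / fact j) = (real j - y)\<^sup>2 * (y ^ j / fact j)" for j
    by (simp only: power2_eq_square) algebra
  moreover have "((y\<^sup>2 + y) * exp y - 2 * y * (y * exp y)) + y\<^sup>2 * exp y = y * exp y"
    by (simp add: power2_eq_square algebra_simps)
  ultimately show "(\<lambda>j. (real j - y)\<^sup>2 * (y ^ j / fact j)) sums (y * exp y)" by simp
qed

section \<open>Moments of the Appell weights\<close>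

text \<open>The Appell polynomials are Cauchy products of \<open>a\<close> with the exponential
  series, so their moments follow from those of the two factors. The coefficients may change sign,
  and the products rest on absolute summability of each factor.\<close>

lemma appell_moment_sums:
  fixes a :: "nat \<Rightarrow> real" and y :: real
  assumes a2: "summable (\<lambda>n. (real n)\<^sup>2 * \<bar>a n\<bar>)" and y: "0 \<le> y"
  shows "(\<lambda>k. appell a k y) sums ((\<Sum>n. a n) * exp y)"
    and "(\<lambda>k. (real k - y)\<^sup>2 * appell a k y) sums
      (((\<Sum>n. (real n)\<^sup>2 * a n) + y * (\<Sum>n. a n)) * exp y)"
proof -
  let ?e = "\<lambda>j. y ^ j / fact j"
  have le: "real n \<le> (real n)\<^sup>2" for n by (cases n) (auto simp: power2_eq_square)
  have a1: "summable (\<lambda>n. norm (real n * a n))"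
    by (rule summable_comparison_test'[OF a2, of 0])
       (use le in \<open>auto simp: abs_mult intro: mult_right_mono\<close>)
  have a0: "summable (\<lambda>n. norm (a n))"
  \<comment> \<open>The comparison starts at index 1 because the weight
    \<open>(real n)\<^sup>2\<close> vanishes at 0.\<close>
  proof (rule summable_comparison_test'[OF a2, of 1])
    fix n :: nat assume "1 \<le> n"
    then have "1 * \<bar>a n\<bar> \<le> (real n)\<^sup>2 * \<bar>a n\<bar>" by (intro mult_right_mono) auto
    then show "norm (norm (a n)) \<le> (real n)\<^sup>2 * \<bar>a n\<bar>" by simp
  qed
  have a2': "summable (\<lambda>n. norm ((real n)\<^sup>2 * a n))" using a2 by (simp add: abs_mult)
  have e0: "summable (\<lambda>j. norm (?e j))" using sums_summable[OF exp_sums[of y]] y by simp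
  have e2: "summable (\<lambda>j. norm ((real j - y)\<^sup>2 * ?e j))"
    using sums_summable[OF exp_centered_moment_sums(2)[of y]] y by simp
  \<comment> \<open>The first absolute moment is dominated by the zeroth and the second, since |s|
    is at most 1 plus the square of s.\<close>
  have e1: "summable (\<lambda>j. norm ((real j - y) * ?e j))"
  proof (rule summable_comparison_test'[OF summable_add[OF e0 e2], of 0])
    fix j :: nat
    have "\<bar>real j - y\<bar> \<le> 1 + (real j - y)\<^sup>2"
      by (cases "\<bar>real j - y\<bar> \<le> 1")
         (use zero_le_power2[of "real j - y"] in linarith,
          use mult_left_mono[of 1 "\<bar>real j - y\<bar>" "\<bar>real j - y\<bar>"] in \<open>auto simp: power2_eq_square\<close>)
    then have "\<bar>real j - y\<bar> * ?e j \<le> (1 + (real j - y)\<^sup>2) * ?e j"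
      using y by (intro mult_right_mono) auto
    then show "norm (norm ((real j - y) * ?e j)) \<le> norm (?e j) + norm ((real j - y)\<^sup>2 * ?e j)"
      using y by (simp add: abs_mult distrib_right add_divide_distrib)
  qed
  have p0: "(\<lambda>k. \<Sum>i\<le>k. a i * ?e (k - i)) sums ((\<Sum>n. a n) * exp y)"
    using Cauchy_product_sums[OF a0 e0] sums_unique[OF exp_sums[of y]] by simp
  then show "(\<lambda>k. appell a k y) sums ((\<Sum>n. a n) * exp y)" by (simp add: appell_def)
  have p2: "(\<lambda>k. \<Sum>i\<le>k. a i * ((real (k - i) - y)\<^sup>2 * ?e (k - i))) sums ((\<Sum>n. a n) * (y * exp y))"
    using Cauchy_product_sums[OF a0 e2] sums_unique[OF exp_centered_moment_sums(2)[of y]] by simp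
  have p1: "(\<lambda>k. \<Sum>i\<le>k. (real i * a i) * ((real (k - i) - y) * ?e (k - i))) sums 0"
    using Cauchy_product_sums[OF a1 e1] sums_unique[OF exp_centered_moment_sums(1)[of y]] by simp
  have p3: "(\<lambda>k. \<Sum>i\<le>k. ((real i)\<^sup>2 * a i) * ?e (k - i)) sums ((\<Sum>n. (real n)\<^sup>2 * a n) * exp y)"
    using Cauchy_product_sums[OF a2' e0] sums_unique[OF exp_sums[of y]] by simp
  \<comment> \<open>In the Cauchy product \<open>k - y = i + (j - y)\<close> with \<open>j = k - i\<close>; the mixed term has sum zero.\<close>
  have split: "(real k - y)\<^sup>2 * appell a k y =
      (\<Sum>i\<le>k. ((real i)\<^sup>2 * a i) * ?e (k - i))
      + 2 * (\<Sum>i\<le>k. (real i * a i) * ((real (k - i) - y) * ?e (k - i)))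
      + (\<Sum>i\<le>k. a i * ((real (k - i) - y)\<^sup>2 * ?e (k - i)))" for k
    unfolding appell_def sum_distrib_left sum.distrib[symmetric]
  proof (rule sum.cong[OF refl])
    fix i assume "i \<in> {..k}"
    then have k: "real k = real i + real (k - i)" by simp
    show "(real k - y)\<^sup>2 * (a i * ?e (k - i)) =
      ((real i)\<^sup>2 * a i) * ?e (k - i) + 2 * ((real i * a i) * ((real (k - i) - y) * ?e (k - i)))
      + a i * ((real (k - i) - y)\<^sup>2 * ?e (k - i))"
      unfolding k by (simp only: power2_eq_square) algebra
  qed
  have "(\<lambda>k. (real k - y)\<^sup>2 * appell a k y) sums
      ((\<Sum>n. (real n)\<^sup>2 * a n) * exp y + 2 * 0 + (\<Sum>n. a n) * (y * exp y))"
    unfolding split by (intro sums_add sums_mult p1 p2 p3)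
  then show "(\<lambda>k. (real k - y)\<^sup>2 * appell a k y) sums
      (((\<Sum>n. (real n)\<^sup>2 * a n) + y * (\<Sum>n. a n)) * exp y)"
    by (simp add: algebra_simps)
qed

section \<open>Increments of functions with a limit relative to the weight\<close>

text \<open>After removal of \<open>K * rho\<close> the remainder \<open>h\<close> is
  o(\<open>rho\<close>). Its increments are controlled by growth when \<open>x\<close> is large or
  \<open>t\<close> is far from \<open>x\<close>, and by uniform continuity otherwise. The increment
  of \<open>K * rho\<close> is quadratic, and its cross term is split by a weighted mean
  inequality.\<close>

lemma C_rho_k_increment_bound:
  assumes f: "f \<in> C_rho_k" and "0 < e"
  obtains C where "0 \<le> C"
    and "\<And>t x. 0 \<le> t \<Longrightarrow> 0 \<le> x \<Longrightarrow> \<bar>f t - f x\<bar> \<le> e * rho x + C * (t - x)\<^sup>2"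
proof -
  have rho_pos: "1 \<le> rho x" for x by (simp add: rho_def)
  \<comment> \<open>Four fifths of \<open>e\<close> are spent on \<open>h\<close> and one fifth on
    \<open>K * rho\<close>.\<close>
  define \<eta> where "\<eta> = e / 5"
  have \<eta>: "0 < \<eta>" using \<open>0 < e\<close> by (simp add: \<eta>_def)
  obtain K where K: "((\<lambda>x. f x / rho x) \<longlongrightarrow> K) at_top" and cf: "continuous_on {0..} f"
    using f by (auto simp: C_rho_k_def)
  define h where "h = (\<lambda>x. f x - K * rho x)"
  have ch: "continuous_on {0..} h"
    unfolding h_def rho_def by (intro continuous_intros cf)
  have "eventually (\<lambda>x. dist (f x / rho x) K < \<eta>) at_top" using K \<eta> by (rule tendstoD)
  then obtain X where X: "\<And>x. X \<le> x \<Longrightarrow> dist (f x / rho x) K < \<eta>"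
    by (auto simp: eventually_at_top_linorder)
  have hX: "\<bar>h x\<bar> \<le> \<eta> * rho x" if "X \<le> x" for x
  proof -
    have r0: "0 < rho x" using rho_pos[of x] by simp
    have "h x = (f x / rho x - K) * rho x" using r0 by (simp add: h_def field_simps)
    then have "\<bar>h x\<bar> = \<bar>f x / rho x - K\<bar> * rho x" using r0 by (simp add: abs_mult)
    also have "\<dots> \<le> \<eta> * rho x"
      using X[OF that] r0 by (intro mult_right_mono) (auto simp: dist_real_def)
    finally show ?thesis .
  qed
  have "compact (h ` {0..X})"
    by (rule compact_continuous_image[OF continuous_on_subset[OF ch]]) auto
  then obtain D where D: "0 < D" "\<And>x. x \<in> {0..X} \<Longrightarrow> \<bar>h x\<bar> \<le> D"
    using compact_imp_bounded bounded_pos by (metis imageI real_norm_def)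
  have hD: "\<bar>h x\<bar> \<le> \<eta> * rho x + D" if "0 \<le> x" for x
  proof (cases "X \<le> x")
    case True then show ?thesis using hX[of x] D(1) by linarith
  next
    case False
    have "0 \<le> \<eta> * rho x" using \<eta> rho_pos[of x] by simp
    then show ?thesis using D(2)[of x] False that by simp
  qed
  \<comment> \<open>The slack is \<open>1 + (t - 2 * x)\<^sup>2\<close>. The bound moves the weight
    from \<open>t\<close> to \<open>x\<close> at the cost of a squared distance.\<close>
  have rho_le: "rho t \<le> 2 * rho x + 2 * (t - x)\<^sup>2" for t x
    using zero_le_power2[of "t - 2 * x"] by (simp add: rho_def power2_eq_square algebra_simps)
  have far: "\<bar>h t - h x\<bar> \<le> 3 * \<eta> * rho x + 2 * \<eta> * (t - x)\<^sup>2 + 2 * D" if "0 \<le> t" "0 \<le> x" for t x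
    using hD[OF that(1)] hD[OF that(2)] mult_left_mono[OF rho_le[of t x], of \<eta>] \<eta>
    by (simp add: algebra_simps)
  \<comment> \<open>From \<open>Y\<close> on, \<open>x * x\<close> is at least \<open>x\<close>,
    hence at least \<open>2 * D / \<eta>\<close>, so the constant \<open>2 * D\<close> is absorbed
    by the weight.\<close>
  define Y where "Y = 1 + 2 * D / \<eta>"
  have Y: "2 * D \<le> \<eta> * rho x" if "Y \<le> x" for x
  proof -
    have "1 \<le> Y" using D \<eta> by (simp add: Y_def)
    then have "x \<le> x * x" using that by (simp add: mult_left_mono[of 1 x x, simplified])
    then have "2 * D / \<eta> \<le> rho x" using that by (simp add: Y_def rho_def power2_eq_square)
    then show ?thesis using \<eta> by (simp add: field_simps)
  qed
  \<comment> \<open>The extra unit keeps \<open>t\<close> in the interval when \<open>x < Y\<close>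
    and \<open>t\<close> is within \<open>\<delta>\<close>, which is at most 1, of
    \<open>x\<close>.\<close>
  have "uniformly_continuous_on {0..Y + 1} h"
    by (rule compact_uniformly_continuous[OF continuous_on_subset[OF ch]]) auto
  then obtain d where d: "0 < d"
      "\<And>t x. t \<in> {0..Y + 1} \<Longrightarrow> x \<in> {0..Y + 1} \<Longrightarrow> dist t x < d \<Longrightarrow> dist (h t) (h x) < \<eta>"
    unfolding uniformly_continuous_on_def using \<eta> by metis
  define \<delta> where "\<delta> = min d 1"
  have \<delta>: "0 < \<delta>" "\<delta> \<le> 1" "\<delta> \<le> d" using d by (auto simp: \<delta>_def)
  \<comment> \<open>Chosen so that \<open>D \<le> E * (t - x)\<^sup>2\<close> as soon as
    \<open>t\<close> and \<open>x\<close> are at least \<open>\<delta>\<close> apart.\<close>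
  define E where "E = D / \<delta>\<^sup>2"
  have hb: "\<bar>h t - h x\<bar> \<le> 4 * \<eta> * rho x + (2 * \<eta> + 2 * E) * (t - x)\<^sup>2"
    if "0 \<le> t" "0 \<le> x" for t x
  proof -
    have nn: "0 \<le> \<eta> * rho x" "0 \<le> \<eta> * (t - x)\<^sup>2" "0 \<le> E * (t - x)\<^sup>2"
      using \<eta> rho_pos[of x] D(1) by (auto simp: E_def less_imp_le)
    consider "Y \<le> x" | "x < Y" "\<bar>t - x\<bar> < \<delta>" | "\<delta> \<le> \<bar>t - x\<bar>" by linarith
    then show ?thesis
    proof cases
      case 1
      then show ?thesis using far[OF that] Y[OF 1] nn by (simp add: algebra_simps)
    next
      case 2
      then have "\<bar>h t - h x\<bar> < \<eta>" using d(2)[of t x] that \<delta> by (auto simp: dist_real_def)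
      moreover have "\<eta> \<le> \<eta> * rho x" using mult_left_mono[OF rho_pos[of x], of \<eta>] \<eta> by simp
      ultimately have "\<bar>h t - h x\<bar> \<le> 4 * (\<eta> * rho x) + 2 * (\<eta> * (t - x)\<^sup>2) + 2 * (E * (t - x)\<^sup>2)"
        using nn by linarith
      then show ?thesis by (simp add: algebra_simps)
    next
      case 3
      then have "\<delta>\<^sup>2 \<le> (t - x)\<^sup>2" using \<delta> by (metis abs_ge_zero less_imp_le power2_abs power_mono)
      then have "1 \<le> (t - x)\<^sup>2 / \<delta>\<^sup>2" using \<delta> by simp
      then have "D \<le> E * (t - x)\<^sup>2"
        using D(1) mult_left_mono[of 1 "(t - x)\<^sup>2 / \<delta>\<^sup>2" D] by (simp add: E_def)
      then show ?thesis using far[OF that] nn by (simp add: algebra_simps)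
    qed
  qed
  define \<kappa> where "\<kappa> = \<bar>K\<bar>"
  define C where "C = 2 * \<eta> + 2 * E + (\<kappa> + \<kappa>\<^sup>2 / \<eta>)"
  have "0 \<le> C" using \<eta> D by (simp add: C_def E_def \<kappa>_def)
  moreover have "\<bar>f t - f x\<bar> \<le> e * rho x + C * (t - x)\<^sup>2" if tx: "0 \<le> t" "0 \<le> x" for t x
  proof -
    define s where "s = \<bar>t - x\<bar>"
    have s2: "s\<^sup>2 = (t - x)\<^sup>2" by (simp add: s_def)
    have "f t - f x = K * ((t - x) * (t - x + 2 * x)) + (h t - h x)"
      by (simp add: h_def rho_def power2_eq_square algebra_simps)
    then have "\<bar>f t - f x\<bar> \<le> \<bar>K * ((t - x) * (t - x + 2 * x))\<bar> + \<bar>h t - h x\<bar>" by simp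
    also have "\<bar>K * ((t - x) * (t - x + 2 * x))\<bar> = \<kappa> * (s * \<bar>t - x + 2 * x\<bar>)"
      by (simp add: abs_mult \<kappa>_def s_def)
    also have "\<dots> \<le> \<kappa> * (s * (s + 2 * x))"
      by (intro mult_left_mono) (use tx in \<open>auto simp: \<kappa>_def s_def\<close>)
    also have "\<dots> \<le> \<eta> * rho x + (\<kappa> + \<kappa>\<^sup>2 / \<eta>) * s\<^sup>2"
    proof -
      \<comment> \<open>This square splits the cross term \<open>2 * \<kappa> * s * x\<close> into a
        small multiple of \<open>x\<^sup>2\<close> and a large multiple of
        \<open>s\<^sup>2\<close>.\<close>
      have "0 \<le> (\<eta> * x - \<kappa> * s)\<^sup>2 / \<eta>" using \<eta> by simp
      also have "\<dots> = \<eta> * x\<^sup>2 - 2 * \<kappa> * s * x + \<kappa>\<^sup>2 / \<eta> * s\<^sup>2"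
        using \<eta> by (simp add: field_simps power2_eq_square)
      finally show ?thesis using \<eta> by (simp add: rho_def power2_eq_square algebra_simps)
    qed
    finally show ?thesis using hb[OF tx] unfolding C_def s2 \<eta>_def by (simp add: algebra_simps)
  qed
  ultimately show thesis by (rule that)
qed

section \<open>Weighted sums of cell averages\<close>

text \<open>The pointwise bound survives averaging over a cell. A point of the \<open>k\<close>-th
  cell is \<open>(real k + v) * \<beta>\<close> with \<open>v\<close> between 0 and 1, and passing
  to the left endpoint costs the factor 2 and the summand 1. Here \<open>x\<close> is fixed, so
  \<open>e\<close> may depend on it.\<close>

lemma kantorovich_mean_estimate:
  fixes w :: "nat \<Rightarrow> real" and f :: "real \<Rightarrow> real"
  assumes w0: "\<And>k. 0 \<le> w k" and w1: "w sums 1"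
    and w2: "(\<lambda>k. (real k - x / \<beta>)\<^sup>2 * w k) sums V"
    and \<beta>: "0 < \<beta>" and C: "0 \<le> C"
    and int: "\<And>k. f integrable_on {real k * \<beta> .. real (k + 1) * \<beta>}"
    and bd: "\<And>t. 0 \<le> t \<Longrightarrow> \<bar>f t - f x\<bar> \<le> e + C * (t - x)\<^sup>2"
  shows "summable (\<lambda>k. w k * (integral {real k * \<beta> .. real (k + 1) * \<beta>} f / \<beta>))"
    and "\<bar>(\<Sum>k. w k * (integral {real k * \<beta> .. real (k + 1) * \<beta>} f / \<beta>)) - f x\<bar>
    \<le> e + 2 * C * \<beta>\<^sup>2 * (V + 1)"
proof -
  define m where "m k = integral {real k * \<beta> .. real (k + 1) * \<beta>} f / \<beta>" for k
  have mb: "\<bar>m k - f x\<bar> \<le> e + 2 * C * \<beta>\<^sup>2 * ((real k - x / \<beta>)\<^sup>2 + 1)" (is "_ \<le> ?B") for k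
  proof -
    let ?I = "{real k * \<beta> .. real (k + 1) * \<beta>}"
    have len: "measure lborel ?I = \<beta>" using \<beta> by (simp add: algebra_simps)
    have pt: "norm (f t - f x) \<le> ?B" if "t \<in> ?I" for t
    proof -
      define v where "v = t / \<beta> - real k"
      have t: "t = (real k + v) * \<beta>" and v: "0 \<le> v" "v \<le> 1"
        using that \<beta> by (auto simp: v_def field_simps)
      define z where "z = real k - x / \<beta>"
      have "t - x = \<beta> * (z + v)" using \<beta> by (simp add: t z_def field_simps)
      then have "(t - x)\<^sup>2 = \<beta>\<^sup>2 * (z + v)\<^sup>2" by (simp add: power_mult_distrib)
      also have "(z + v)\<^sup>2 \<le> 2 * (z\<^sup>2 + 1)"
        using zero_le_power2[of "z - v"] mult_mono[OF v(2) v(2)] v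
        by (simp add: power2_eq_square algebra_simps)
      finally have "(t - x)\<^sup>2 \<le> \<beta>\<^sup>2 * (2 * (z\<^sup>2 + 1))" by (simp add: mult_left_mono)
      then have "C * (t - x)\<^sup>2 \<le> C * (\<beta>\<^sup>2 * (2 * (z\<^sup>2 + 1)))" using C by (rule mult_left_mono)
      moreover have "0 \<le> t" using t v \<beta> by simp
      ultimately show ?thesis using bd[of t] by (simp add: z_def algebra_simps)
    qed
    have "((\<lambda>t. f t - f x) has_integral (integral ?I f - \<beta> * f x)) ?I"
      using has_integral_diff[OF integrable_integral[OF int[of k]]
          has_integral_const_real[of "f x" "real k * \<beta>" "real (k + 1) * \<beta>"]]
      using \<beta> by (simp add: algebra_simps)
    \<comment> \<open>Nonnegativity of the bound is read off from the pointwise estimate at the left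
      endpoint.\<close>
    moreover have "0 \<le> ?B" using pt[of "real k * \<beta>"] \<beta> norm_ge_zero order_trans
      by (fastforce simp: algebra_simps)
    ultimately have "norm (integral ?I f - \<beta> * f x) \<le> ?B * measure lborel ?I"
      using has_integral_bound_real[of ?B "{}" "\<lambda>t. f t - f x" "integral ?I f - \<beta> * f x"] pt by blast
    then have "\<bar>integral ?I f - \<beta> * f x\<bar> / \<beta> \<le> ?B"
      using \<beta> unfolding len by (simp add: field_simps)
    also have "\<bar>integral ?I f - \<beta> * f x\<bar> / \<beta> = \<bar>m k - f x\<bar>"
    proof -
      have "m k - f x = (integral ?I f - \<beta> * f x) / \<beta>"
        using \<beta> by (simp add: m_def diff_divide_distrib)
      then show ?thesis using \<beta> by (simp add: abs_divide)
    qed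
    finally show ?thesis .
  qed
  have B: "(\<lambda>k. w k * (e + 2 * C * \<beta>\<^sup>2 * ((real k - x / \<beta>)\<^sup>2 + 1))) sums
      (e * 1 + 2 * C * \<beta>\<^sup>2 * (V + 1))"
    using sums_add[OF sums_mult[OF w1, of e] sums_mult[OF sums_add[OF w2 w1], of "2 * C * \<beta>\<^sup>2"]]
    by (simp add: algebra_simps)
  have le: "norm (w k * (m k - f x)) \<le> w k * (e + 2 * C * \<beta>\<^sup>2 * ((real k - x / \<beta>)\<^sup>2 + 1))" for k
    using mult_left_mono[OF mb[of k] w0[of k]] w0[of k] by (simp add: abs_mult)
  have sm: "summable (\<lambda>k. w k * (m k - f x))"
    by (rule summable_comparison_test'[OF sums_summable[OF B], of 0]) (use le in auto)
  \<comment> \<open>Total mass 1 lets the constant \<open>f x\<close> be added back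
    termwise.\<close>
  have "(\<lambda>k. w k * (m k - f x) + w k * f x) sums ((\<Sum>k. w k * (m k - f x)) + 1 * f x)"
    by (intro sums_add summable_sums[OF sm] sums_mult2 w1)
  then have m: "(\<lambda>k. w k * m k) sums ((\<Sum>k. w k * (m k - f x)) + f x)"
    by (simp add: algebra_simps)
  then show "summable (\<lambda>k. w k * (integral {real k * \<beta> .. real (k + 1) * \<beta>} f / \<beta>))"
    unfolding m_def by (rule sums_summable)
  have "(\<Sum>k. w k * m k) = (\<Sum>k. w k * (m k - f x)) + f x"
    using sums_unique[OF m] by simp
  moreover have "norm (\<Sum>k. w k * (m k - f x)) \<le> (\<Sum>k. w k * (e + 2 * C * \<beta>\<^sup>2 * ((real k - x / \<beta>)\<^sup>2 + 1)))"
    by (rule norm_suminf_le) (use le sums_summable[OF B] in auto)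
  ultimately show "\<bar>(\<Sum>k. w k * (integral {real k * \<beta> .. real (k + 1) * \<beta>} f / \<beta>)) - f x\<bar>
    \<le> e + 2 * C * \<beta>\<^sup>2 * (V + 1)" using sums_unique[OF B] by (simp add: m_def)
qed

section \<open>Positivity of the Appell weights\<close>

text \<open>Positivity is tested on the indicator of the open cell: it vanishes on the interiors of
  all other cells, so its series has a single nonzero term.\<close>

lemma positive_operator_imp_appell_nonneg:
  assumes pos: "positive_operator (JL_domain a b n) (JL_kantorovich a b n)"
    and n: "1 \<le> n" and bn: "0 < b n" and y: "0 \<le> y"
  shows "0 \<le> appell a k y / gen_fun a (1::real)"
proof -
  define \<beta> where "\<beta> = b n / real n"
  have \<beta>: "0 < \<beta>" using n bn by (simp add: \<beta>_def)
  have cell: "cell b n j = cbox (real j * \<beta>) (real (j + 1) * \<beta>)" for j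
    by (simp add: cell_def \<beta>_def)
  define g :: "real \<Rightarrow> real" where "g = indicator (box (real k * \<beta>) (real (k + 1) * \<beta>))"
  have gj: "(g has_integral (if j = k then \<beta> else 0)) (cell b n j)" for j
  proof (cases "j = k")
    case True
    have "((\<lambda>t. 1) has_integral \<beta>) (cell b n k)"
      using has_integral_const_real[of "1::real" "real k * \<beta>" "real (k + 1) * \<beta>"] \<beta>
      by (simp add: cell algebra_simps)
    then have "(g has_integral \<beta>) (cell b n k)"
      unfolding cell by (rule has_integral_spike_interior) (simp add: g_def)
    then show ?thesis using True by simp
  next
    case False
    have "g t = 0" if "t \<in> box (real j * \<beta>) (real (j + 1) * \<beta>)" for t
    proof (rule ccontr)
      assume "g t \<noteq> 0"
      then have t: "real k * \<beta> < t" "t < real (k + 1) * \<beta>" "real j * \<beta> < t" "t < real (j + 1) * \<beta>"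
        using that by (auto simp: g_def indicator_def split: if_splits)
      then have "real k * \<beta> < real (j + 1) * \<beta>" "real j * \<beta> < real (k + 1) * \<beta>" by linarith+
      then have "real k < real (j + 1)" "real j < real (k + 1)"
        using \<beta> mult_less_cancel_right_pos by blast+
      then show False using False by linarith
    qed
    then have "(g has_integral 0) (cell b n j)"
      unfolding cell by (intro has_integral_spike_interior[OF has_integral_0]) auto
    then show ?thesis using False by simp
  qed
  then have gi: "integral (cell b n j) g = (if j = k then \<beta> else 0)" for j
    by (rule integral_unique)
  have S: "(\<lambda>j. appell a j z * integral (cell b n j) g) sums (appell a k z * \<beta>)" for z
    using sums_single[of k "\<lambda>j. appell a j z * \<beta>"] by (simp add: gi if_distrib cong: if_cong)
  have "g \<in> JL_domain a b n"
    unfolding JL_domain_def using gj S by (blast intro: has_integral_integrable sums_summable)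
  moreover have "\<forall>t\<ge>0. 0 \<le> g t" by (simp add: g_def)
  \<comment> \<open>The operator is evaluated at \<open>y * \<beta>\<close>, where the rescaled
    argument of the Appell polynomials is \<open>y\<close>.\<close>
  moreover have "0 \<le> y * \<beta>" using y \<beta> by simp
  ultimately have "0 \<le> JL_kantorovich a b n g (y * \<beta>)"
    using pos unfolding positive_operator_def by blast
  also have "JL_kantorovich a b n g (y * \<beta>) = exp (- y) * (appell a k y / gen_fun a (1::real))"
  proof -
    have "real n / b n = 1 / \<beta>" by (simp add: \<beta>_def)
    then show ?thesis unfolding JL_kantorovich_def using \<beta> sums_unique[OF S[of y], symmetric] by simp
  qed
  finally show ?thesis by (metis exp_gt_zero mult_le_cancel_left_pos mult_zero_right)
qed

section \<open>Pointwise error of the operator\<close>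

text \<open>The normalised Appell weights are nonnegative with total mass 1 and second moment
  \<open>y + c\<close> about \<open>y\<close>, so the estimate for cell averages applies with
  \<open>V = y + c\<close>.\<close>

lemma JL_kantorovich_error:
  assumes a2: "summable (\<lambda>n. (real n)\<^sup>2 * \<bar>a n\<bar>)" and g1: "gen_fun a (1::real) \<noteq> 0"
    and pos: "positive_operator (JL_domain a b n) (JL_kantorovich a b n)"
    and n: "1 \<le> n" and bn: "0 < b n" and x: "0 \<le> x" and C: "0 \<le> C"
    and cf: "continuous_on {0..} f"
    and bd: "\<And>t. 0 \<le> t \<Longrightarrow> \<bar>f t - f x\<bar> \<le> e + C * (t - x)\<^sup>2"
  defines "c \<equiv> (\<Sum>n. (real n)\<^sup>2 * a n) / (\<Sum>n. a n)"
  shows "\<bar>JL_kantorovich a b n f x - f x\<bar>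
    \<le> e + 2 * C * (b n / real n)\<^sup>2 * (x / (b n / real n) + c + 1)"
proof -
  define \<beta> where "\<beta> = b n / real n"
  define y where "y = x / \<beta>"
  have \<beta>: "0 < \<beta>" and y: "0 \<le> y" using n bn x by (auto simp: \<beta>_def y_def)
  define G where "G = gen_fun a (1::real)"
  have G: "G = (\<Sum>n. a n)" "G \<noteq> 0" using g1 by (auto simp: G_def gen_fun_def)
  define w where "w k = exp (- y) / G * appell a k y" for k
  have w0: "0 \<le> w k" for k
    using positive_operator_imp_appell_nonneg[OF pos n bn y, of k]
      mult_nonneg_nonneg[of "exp (- y)" "appell a k y / G"]
    by (simp add: w_def G_def)
  have "w sums (exp (- y) / G * (G * exp y))"
    unfolding w_def G(1) by (intro sums_mult appell_moment_sums a2 y)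
  then have w1: "w sums 1" using G(2) by (simp add: exp_minus)
  have "(\<lambda>k. exp (- y) / G * ((real k - y)\<^sup>2 * appell a k y)) sums
      (exp (- y) / G * (((\<Sum>n. (real n)\<^sup>2 * a n) + y * G) * exp y))"
    unfolding G(1) by (intro sums_mult appell_moment_sums a2 y)
  moreover have "exp (- y) / G * (((\<Sum>n. (real n)\<^sup>2 * a n) + y * G) * exp y) = y + c"
    using G(2) by (simp add: c_def G(1)[symmetric] exp_minus field_simps)
  ultimately have w2: "(\<lambda>k. (real k - x / \<beta>)\<^sup>2 * w k) sums (y + c)"
    by (simp add: w_def y_def mult_ac)
  have int: "f integrable_on {real k * \<beta> .. real (k + 1) * \<beta>}" for k
  proof (rule integrable_continuous_real[OF continuous_on_subset[OF cf]])
    show "{real k * \<beta> .. real (k + 1) * \<beta>} \<subseteq> {0..}"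
      using \<beta> by (auto intro: order_trans[OF _ atLeastAtMost_iff[THEN iffD1, THEN conjunct1]])
  qed
  have eq: "JL_kantorovich a b n f x =
      (\<Sum>k. w k * (integral {real k * \<beta> .. real (k + 1) * \<beta>} f / \<beta>))"
  proof -
    have nb: "real n / b n = 1 / \<beta>" by (simp add: \<beta>_def)
    have cell: "cell b n k = {real k * \<beta> .. real (k + 1) * \<beta>}" for k
      by (simp add: cell_def \<beta>_def)
    define I where "I k = integral (cell b n k) f" for k
    \<comment> \<open>Moving the normalising factor through the series needs convergence, which the
      averaging estimate also supplies.\<close>
    have sm: "summable (\<lambda>k. w k * (I k / \<beta>))"
      unfolding I_def cell by (rule kantorovich_mean_estimate(1)[OF w0 w1 w2 \<beta> C int bd])
    have summand: "appell a k y * I k = (G * exp y * \<beta>) * (w k * (I k / \<beta>))" for k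
      using G(2) \<beta> by (simp add: w_def exp_minus field_simps)
    have "(\<Sum>k. appell a k y * I k) = (G * exp y * \<beta>) * (\<Sum>k. w k * (I k / \<beta>))"
      unfolding summand by (rule suminf_mult[OF sm])
    moreover have "JL_kantorovich a b n f x = exp (- y) / G * (1 / \<beta>) * (\<Sum>k. appell a k y * I k)"
      unfolding JL_kantorovich_def nb I_def G_def y_def by simp
    ultimately have "JL_kantorovich a b n f x = (\<Sum>k. w k * (I k / \<beta>))"
      using G(2) \<beta> by (simp add: exp_minus field_simps)
    then show ?thesis by (simp add: I_def cell)
  qed
  show ?thesis
    using kantorovich_mean_estimate(2)[OF w0 w1 w2 \<beta> C int bd] unfolding eq
    by (simp add: \<beta>_def y_def)
qed

section \<open>Convergence in the weighted norm\<close>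

theorem theorem7:
  fixes a b :: "nat \<Rightarrow> real" and r :: real and f :: "real \<Rightarrow> real"
  assumes "1 < r"
    and "\<And>u::complex. norm u < r \<Longrightarrow> summable (\<lambda>n. of_real (a n) * u ^ n)"
    and "(gen_fun a :: complex \<Rightarrow> complex) analytic_on ball 0 r"
    and "gen_fun a (1::real) \<noteq> 0"
    and "\<And>n. 1 \<le> n \<Longrightarrow> 0 < b n"
    and "mono_on {1..} b"
    and "filterlim b at_top sequentially"
    and "(\<lambda>n. b n / real n) \<longlonglongrightarrow> 0"
    and "\<And>n. 1 \<le> n \<Longrightarrow> positive_operator (JL_domain a b n) (JL_kantorovich a b n)"
    and "f \<in> C_rho_k"
  shows "(\<lambda>n. rho_norm (\<lambda>x. JL_kantorovich a b n f x - f x)) \<longlonglongrightarrow> 0"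
proof -
  have a2: "summable (\<lambda>n. (real n)\<^sup>2 * \<bar>a n\<bar>)" by (rule summable_square_coeffs[OF assms(1,2)])
  define c where "c = (\<Sum>n. (real n)\<^sup>2 * a n) / (\<Sum>n. a n)"
  have cf: "continuous_on {0..} f" using assms(10) by (simp add: C_rho_k_def)
  have small: "eventually (\<lambda>n. rho_norm (\<lambda>x. JL_kantorovich a b n f x - f x) \<le> ennreal \<epsilon>) sequentially"
    if \<epsilon>: "0 < \<epsilon>" for \<epsilon>
  proof -
    obtain C where C: "0 \<le> C"
      "\<And>t x. 0 \<le> t \<Longrightarrow> 0 \<le> x \<Longrightarrow> \<bar>f t - f x\<bar> \<le> (\<epsilon> / 2) * rho x + C * (t - x)\<^sup>2"
      using C_rho_k_increment_bound[OF assms(10), of "\<epsilon> / 2"] half_gt_zero[OF \<epsilon>] by metis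
    \<comment> \<open>This is the coefficient of \<open>rho x\<close> left by the moment term:
      \<open>2 * C * \<beta>\<^sup>2 * (x / \<beta>)\<close> equals
      \<open>C * \<beta> * (2 * x)\<close>, and \<open>2 * x \<le> rho x\<close>.\<close>
    have "(\<lambda>n. C * (b n / real n) + 2 * C * (b n / real n)\<^sup>2 * (\<bar>c\<bar> + 1)) \<longlonglongrightarrow>
        C * 0 + 2 * C * 0\<^sup>2 * (\<bar>c\<bar> + 1)"
      by (intro tendsto_intros assms(8))
    then have "(\<lambda>n. C * (b n / real n) + 2 * C * (b n / real n)\<^sup>2 * (\<bar>c\<bar> + 1)) \<longlonglongrightarrow> 0" by simp
    then have "eventually (\<lambda>n. C * (b n / real n) + 2 * C * (b n / real n)\<^sup>2 * (\<bar>c\<bar> + 1) < \<epsilon> / 2) sequentially"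
      by (rule order_tendstoD) (use \<epsilon> in simp)
    with eventually_ge_at_top[of 1] show ?thesis
    proof eventually_elim
      case (elim n)
      define \<beta> where "\<beta> = b n / real n"
      have \<beta>: "0 < \<beta>" using assms(5)[of n] elim by (simp add: \<beta>_def)
      have "\<bar>JL_kantorovich a b n f x - f x\<bar> / rho x \<le> \<epsilon>" if x: "0 \<le> x" for x
      proof -
        have rho: "2 * x \<le> rho x" "1 \<le> rho x"
          using zero_le_power2[of "x - 1"] by (auto simp: rho_def power2_eq_square algebra_simps)
        have "\<bar>JL_kantorovich a b n f x - f x\<bar>
            \<le> (\<epsilon> / 2) * rho x + 2 * C * \<beta>\<^sup>2 * (x / \<beta> + c + 1)"
          unfolding \<beta>_def c_def
          by (rule JL_kantorovich_error[OF a2 assms(4) assms(9)[OF elim(1)] elim(1) assms(5)[OF elim(1)] x C(1) cf])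
             (use C(2) x in auto)
        also have "2 * C * \<beta>\<^sup>2 * (x / \<beta> + c + 1) = C * \<beta> * (2 * x) + 2 * C * \<beta>\<^sup>2 * (c + 1)"
          using \<beta> by (simp add: field_simps power2_eq_square)
        also have "\<dots> \<le> C * \<beta> * rho x + 2 * C * \<beta>\<^sup>2 * ((\<bar>c\<bar> + 1) * rho x)"
        proof (intro add_mono mult_left_mono)
          \<comment> \<open>Since \<open>c\<close> may be negative, the absolute value provides a
            nonnegative factor before multiplication by \<open>rho x\<close>.\<close>
          have "c + 1 \<le> (\<bar>c\<bar> + 1) * 1" by simp
          also have "\<dots> \<le> (\<bar>c\<bar> + 1) * rho x" using rho(2) by (intro mult_left_mono) auto
          finally show "c + 1 \<le> (\<bar>c\<bar> + 1) * rho x" .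
        qed (use rho C(1) \<beta> in auto)
        also have "\<dots> = (C * \<beta> + 2 * C * \<beta>\<^sup>2 * (\<bar>c\<bar> + 1)) * rho x" by (simp add: algebra_simps)
        also have "\<dots> \<le> (\<epsilon> / 2) * rho x"
          using elim(2) rho(2) unfolding \<beta>_def by (intro mult_right_mono) auto
        finally show ?thesis using rho(2) by (simp add: field_simps)
      qed
      then show ?case unfolding rho_norm_def by (intro SUP_least ennreal_leI) auto
    qed
  qed
  show ?thesis
  proof (rule order_tendstoI)
    fix l :: ennreal assume "0 < l"
    \<comment> \<open>The level \<open>l\<close> may be infinite; a value strictly between 0 and
      \<open>l\<close> is finite, hence comes from a positive real.\<close>
    then obtain l' where "0 < l'" "l' < l" using dense by blast
    then obtain \<epsilon> where \<epsilon>: "0 < \<epsilon>" "ennreal \<epsilon> < l"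
      by (cases l' rule: ennreal_cases) auto
    show "eventually (\<lambda>n. rho_norm (\<lambda>x. JL_kantorovich a b n f x - f x) < l) sequentially"
      using small[OF \<epsilon>(1)] by eventually_elim (use \<epsilon>(2) in auto)
  qed auto
qed

end
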